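(* Let $\lambda \ge 0$ and let $g : \mathbb{R}^N \to \mathbb{R}$ be a differentiable function. The minimization problem $$\min_{\bm{x} \in \mathbb{R}^N} \; g(\bm{x}) + \lambda\, \psi_K(\bm{x})$$ is equivalent, via the reparameterization $\bm{x} = \bm{u} \odot \bm{\sigma} \in \mathbb{R}^N$, to the problem $$\min_{\bm{u}, \bm{\sigma} \in \mathbb{R}^N} \; g(\bm{u} \odot \bm{\sigma}) + \frac{\lambda}{2}\left(\|\bm{u}\|_2^2 + \|\bm{\sigma}\|_2^2\right) \quad \text{subject to} \quad \|\bm{D}\bm{\sigma}\|_0 \le K-1.$$
   Context: For $\bm{x} \in \mathbb{R}^N$, the combinatorial latent optimally partitioned (LOP) $\ell_2/\ell_1$ penalty is $$\psi_K(\bm{x}) := \min_{j \in \{1,\dots,K\}} \; \min_{\{\mathcal{B}_k\}_{k=1}^j \in \mathcal{P}_j} \; \sum_{k=1}^j \sqrt{|\mathcal{B}_k|}\, \|\bm{x}_{\mathcal{B}_k}\|_2 ,$$ where $\mathcal{P}_j$ is the family of nonoverlapping partitions $\{\mathcal{B}_k\}_{k=1}^j$ of $\{1,\dots,N\}$ into $j$ contiguous blocks $\mathcal{B}_k$, $|\mathcal{B}|$ is the cardinality of a block $\mathcal{B}$, and $\bm{x}_{\mathcal{B}} = (x_n)_{n \in \mathcal{B}}$. The symbol $\odot$ is the element-wise (Hadamard) product, $\|\cdot\|_2$ is the Euclidean norm, and $\|\cdot\|_0$ counts the nonzero entries of a vector. $\bm{D} \in \mathbb{R}^{(N-1)\times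 N}$ is the first-order finite difference matrix, $(\bm{D}\bm{\sigma})_i = \sigma_{i+1} - \sigma_i$. The reparameterization $\bm{x} = \bm{u} \odot \bm{\sigma}$ is called Deep Weight Factorization (DWF). The word "equivalent" is not further defined in the statement; the accompanying proof expresses it as equality of the minimum values of the two problems. *)

theory Defs
  imports "HOL-Analysis.Analysis" "HOL-Library.Disjoint_Sets" "Jordan_Normal_Form.Matrix"
begin

text \<open>
  The index set \<open>{1, \<dots>, N}\<close> is an arbitrary finite linearly ordered type \<open>'n\<close>
  with \<open>N = CARD('n)\<close>, so that vectors of \<open>\<real>\<^sup>N\<close> live in the Euclidean space \<open>real ^ 'n\<close>.
  Multiplication on \<open>real ^ 'n\<close> is component-wise, so the Hadamard product of
  \<open>u\<close> and \<open>\<sigma>\<close> is \<open>u * \<sigma>\<close>.  The codomain \<open>\<real>\<^sup>N\<^sup>-\<^sup>1\<close> of the difference matrix may have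
  dimension 0, hence it is modelled by dimension-indexed vectors instead.
\<close>

no_notation vec_index (infixl "$" 100)

definition contiguous_partitions :: "nat \<Rightarrow> 'n::{finite,linorder} set set set" where
  "contiguous_partitions j =
     {P. partition_on UNIV P \<and> card P = j \<and> (\<forall>B\<in>P. \<exists>a b. B = {a..b})}"

definition block_cost :: "real ^ 'n \<Rightarrow> 'n::finite set set \<Rightarrow> real" where
  "block_cost x P = (\<Sum>B\<in>P. sqrt (real (card B)) * L2_set (\<lambda>n. x $ n) B)"

text \<open>
  There are no partitions into more than \<open>N\<close> blocks; taking one minimum over the union
  amounts to counting the minimum over such an empty family as \<open>+\<infinity>\<close>.
\<close>

definition lop_penalty :: "nat \<Rightarrow> real ^ 'n::{finite,linorder} \<Rightarrow> real" where
  "lop_penalty K x = Min (\<Union>j\<in>{1..K}. block_cost x ` contiguous_partitions j)"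

definition diff_mat :: "nat \<Rightarrow> real mat" where
  "diff_mat N = mat (N - 1) N (\<lambda>(i, j). if j = i + 1 then 1 else if j = i then - 1 else 0)"

definition coords :: "real ^ 'n::{finite,linorder} \<Rightarrow> real Matrix.vec" where
  "coords x = vec_of_list (map (\<lambda>n. x $ n) (sorted_list_of_set UNIV))"

definition l0_norm :: "real Matrix.vec \<Rightarrow> nat" where
  "l0_norm v = card {i. i < dim_vec v \<and> vec_index v i \<noteq> 0}"

definition lop_objective ::
    "(real ^ 'n::{finite,linorder} \<Rightarrow> real) \<Rightarrow> real \<Rightarrow> nat
      \<Rightarrow> real ^ 'n::{finite,linorder} \<Rightarrow> real" where
  "lop_objective g lam K x = g x + lam * lop_penalty K x"

definition dwf_objective ::
    "(real ^ 'n \<Rightarrow> real) \<Rightarrow> real \<Rightarrow> (real ^ 'n) \<times> (real ^ 'n) \<Rightarrow> real" where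
  "dwf_objective g lam = (\<lambda>(u, \<sigma>). g (u * \<sigma>) + lam / 2 * ((norm u)\<^sup>2 + (norm \<sigma>)\<^sup>2))"

definition dwf_feasible ::
    "nat \<Rightarrow> (real ^ 'n::{finite,linorder}) \<times> (real ^ 'n::{finite,linorder}) \<Rightarrow> bool" where
  "dwf_feasible K = (\<lambda>(u, \<sigma>). l0_norm (diff_mat CARD('n) *\<^sub>v coords \<sigma>) \<le> K - 1)"

lemma dim_coords [simp]: "dim_vec (coords (x :: real ^ 'n::{finite,linorder})) = CARD('n)"
  by (simp add: coords_def)

lemma diff_mat_mult_coords:
  fixes x :: "real ^ 'n::{finite,linorder}"
  assumes "i < CARD('n) - 1"
  shows "vec_index (diff_mat CARD('n) *\<^sub>v coords x) i
           = vec_index (coords x) (i + 1) - vec_index (coords x) i"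
proof -
  have "vec_index (diff_mat CARD('n) *\<^sub>v coords x) i =
     (\<Sum>j\<in>{0..<CARD('n)}. (if j = i + 1 then vec_index (coords x) j else 0)
        - (if j = i then vec_index (coords x) j else 0))"
    using assms by (auto simp: diff_mat_def scalar_prod_def intro!: sum.cong)
  then show ?thesis
    using assms by (auto simp: sum_subtractf)
qed

lemma lop_penalty_Min_well_defined:
  fixes x :: "real ^ 'n::{finite,linorder}"
  assumes "1 \<le> K"
  defines "S \<equiv> \<Union>j\<in>{1..K}. block_cost x ` contiguous_partitions j"
  shows "finite S" and "S \<noteq> {}"
proof -
  show "finite S"
    unfolding S_def by (intro finite_UN_I finite_imageI) auto
  have "(UNIV :: 'n set) = {Min UNIV..Max UNIV}"
    by auto
  then have "{UNIV} \<in> (contiguous_partitions 1 :: 'n set set set)"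
    unfolding contiguous_partitions_def by (auto simp: partition_on_def)
  then show "S \<noteq> {}"
    unfolding S_def using assms(1) by fastforce
qed

end

theory Submission
  imports Defs
begin

text \<open>
  If \<open>\<sigma>\<close> takes the constant value \<open>s\<close> on a block \<open>B\<close>, then AM-GM gives
  \<open>sqrt |B| * \<parallel>(u * \<sigma>)\<^sub>B\<parallel> \<le> (\<parallel>u\<^sub>B\<parallel>\<^sup>2 + \<parallel>\<sigma>\<^sub>B\<parallel>\<^sup>2) / 2\<close>, with equality for a suitable choice of
  \<open>s\<close> when only the product \<open>u * \<sigma>\<close> is prescribed.  Since \<open>\<sigma>\<close> has at most \<open>K - 1\<close> jumps iff it
  is constant on the blocks of some contiguous partition into at most \<open>K\<close> blocks, the LOP
  objective at \<open>x\<close> is the minimum of the DWF objective over the feasible factorizations of \<open>x\<close>.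
  Both claims follow by minimizing over \<open>x\<close>.
\<close>

section \<open>Jumps of \<sigma> and partitions into intervals\<close>

text \<open>Each nonzero entry of the difference vector is recorded by the right end of its pair of
  neighbours. This allows arguing in the order of \<open>'n\<close> rather than with numeric
  positions. The least index has no predecessor, so it is never a jump.\<close>

definition jumps :: "real ^ 'n::{finite,linorder} \<Rightarrow> 'n set" where
  "jumps \<sigma> = {m. \<exists>l<m. {l<..<m} = {} \<and> \<sigma> $ l \<noteq> \<sigma> $ m}"

text \<open>With \<open>e\<close> the increasing enumeration of the index type, row \<open>i\<close>
  of the difference matrix corresponds to the candidate jump \<open>e (Suc i)\<close>. This is a
  bijection because consecutive positions are exactly the pairs with nothing strictly between
  them.\<close>

lemma l0_norm_diff_eq_card_jumps:
  fixes \<sigma> :: "real ^ 'n::{finite,linorder}"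
  shows "l0_norm (diff_mat CARD('n) *\<^sub>v coords \<sigma>) = card (jumps \<sigma>)"
proof -
  define e where "e i = sorted_list_of_set (UNIV :: 'n set) ! i" for i
  have len: "length (sorted_list_of_set (UNIV :: 'n set)) = CARD('n)"
    by simp
  have e_less: "e i < e j" if "i < j" "j < CARD('n)" for i j
    unfolding e_def using that
    by (intro sorted_wrt_nth_less[where P = "(<)"]) auto
  have e_less_iff: "e i < e j \<longleftrightarrow> i < j" if "i < CARD('n)" "j < CARD('n)" for i j
    using e_less[of i j] e_less[of j i] that by (cases i j rule: linorder_cases) auto
  have e_surj: "\<exists>i<CARD('n). e i = m" for m
    using in_set_conv_nth[of m "sorted_list_of_set UNIV"] len unfolding e_def by auto
  define S where "S = {i. Suc i < CARD('n) \<and> \<sigma> $ e (Suc i) \<noteq> \<sigma> $ e i}"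
  have coords_e: "vec_index (coords \<sigma>) i = \<sigma> $ e i" if "i < CARD('n)" for i
    using that by (simp add: coords_def e_def vec_of_list_index)
  have "dim_vec (diff_mat CARD('n) *\<^sub>v coords \<sigma>) = CARD('n) - 1"
    by (simp add: diff_mat_def)
  moreover have "vec_index (diff_mat CARD('n) *\<^sub>v coords \<sigma>) i = \<sigma> $ e (Suc i) - \<sigma> $ e i"
    if "i < CARD('n) - 1" for i
    using that by (subst diff_mat_mult_coords) (auto simp: coords_e)
  ultimately have "l0_norm (diff_mat CARD('n) *\<^sub>v coords \<sigma>) = card S"
    unfolding l0_norm_def S_def by (intro arg_cong[where f = card]) auto
  moreover have "inj_on (\<lambda>i. e (Suc i)) S"
  proof (rule linorder_inj_onI')
    fix i j assume "i \<in> S" "j \<in> S" "i < j"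
    then have "e (Suc i) < e (Suc j)"
      by (intro e_less) (auto simp: S_def)
    then show "e (Suc i) \<noteq> e (Suc j)"
      by simp
  qed
  moreover have "(\<lambda>i. e (Suc i)) ` S = jumps \<sigma>"
  proof (intro equalityI subsetI)
    fix m assume "m \<in> (\<lambda>i. e (Suc i)) ` S"
    then obtain i where i: "Suc i < CARD('n)" "\<sigma> $ e (Suc i) \<noteq> \<sigma> $ e i" "m = e (Suc i)"
      by (auto simp: S_def)
    have "k \<notin> {e i<..<e (Suc i)}" for k
    proof -
      obtain k' where "k' < CARD('n)" "e k' = k"
        using e_surj by blast
      then show ?thesis
        using e_less_iff[of i k'] e_less_iff[of k' "Suc i"] i(1) by auto
    qed
    then have "{e i<..<e (Suc i)} = {}"
      by blast
    moreover have "e i < m" "\<sigma> $ e i \<noteq> \<sigma> $ m"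
      using i e_less[of i "Suc i"] by auto
    ultimately show "m \<in> jumps \<sigma>"
      unfolding jumps_def i(3) by blast
  next
    fix m assume "m \<in> jumps \<sigma>"
    then obtain l where l: "l < m" "{l<..<m} = {}" "\<sigma> $ l \<noteq> \<sigma> $ m"
      by (auto simp: jumps_def)
    obtain i j where ij: "i < CARD('n)" "j < CARD('n)" "e i = l" "e j = m"
      using e_surj by metis
    have "i < j"
      using ij l e_less_iff by auto
    moreover have "\<not> Suc i < j"
    proof
      assume "Suc i < j"
      then have "e (Suc i) \<in> {l<..<m}"
        using ij e_less by auto
      then show False
        using l by simp
    qed
    ultimately have "j = Suc i"
      by simp
    then show "m \<in> (\<lambda>i. e (Suc i)) ` S"
      using ij l by (auto simp: S_def)
  qed
  ultimately show ?thesis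
    by (metis card_image)
qed

text \<open>Descend from \<open>m\<close> to its immediate predecessor: the value cannot change,
  since \<open>m\<close> is not a jump. The induction measure counts the indices below
  \<open>m\<close>.\<close>

lemma eq_if_no_jumps_between:
  fixes \<sigma> :: "real ^ 'n::{finite,linorder}"
  assumes "n \<le> m" "jumps \<sigma> \<inter> {n<..m} = {}"
  shows "\<sigma> $ n = \<sigma> $ m"
  using assms
proof (induction "card {..<m}" arbitrary: m rule: less_induct)
  case less
  show ?case
  proof (cases "n = m")
    case False
    then have "n < m"
      using less.prems by simp
    define l where "l = Max {..<m}"
    have "l \<in> {..<m}"
      unfolding l_def using \<open>n < m\<close> by (intro Max_in) auto
    have l_max: "k \<le> l" if "k < m" for k
      unfolding l_def using that by (intro Max_ge) auto
    have "card {..<l} < card {..<m}"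
      using \<open>l \<in> {..<m}\<close> by (intro psubset_card_mono) auto
    then have "\<sigma> $ n = \<sigma> $ l"
      using less.prems \<open>l \<in> {..<m}\<close> l_max[OF \<open>n < m\<close>]
      by (intro less.hyps) (auto simp: disjoint_iff)
    moreover have "{l<..<m} = {}"
      using l_max by fastforce
    then have "\<sigma> $ l = \<sigma> $ m"
      using less.prems \<open>l \<in> {..<m}\<close> \<open>n < m\<close> unfolding jumps_def by fastforce
    ultimately show ?thesis
      by simp
  qed simp
qed

text \<open>Every jump is the least element of its block, and so is \<open>Min UNIV\<close>, which
  is not a jump. This one extra block minimum makes the inequality strict.\<close>

lemma card_jumps_less_card_partition:
  fixes \<sigma> :: "real ^ 'n::{finite,linorder}"
  assumes P: "P \<in> contiguous_partitions j"
    and const: "\<And>B m n. B \<in> P \<Longrightarrow> m \<in> B \<Longrightarrow> n \<in> B \<Longrightarrow> \<sigma> $ m = \<sigma> $ n"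
  shows "card (jumps \<sigma>) < j"
proof -
  have part: "partition_on UNIV P" and card: "card P = j"
    and interval: "\<And>B. B \<in> P \<Longrightarrow> \<exists>a b. B = {a..b}"
    using P by (auto simp: contiguous_partitions_def)
  have block: "\<exists>B\<in>P. n \<in> B" for n
    using partition_onD1[OF part] by blast
  have "Min UNIV \<notin> jumps \<sigma>"
    by (auto simp: jumps_def)
  then have "Suc (card (jumps \<sigma>)) = card (insert (Min UNIV) (jumps \<sigma>))"
    by simp
  also have "insert (Min UNIV) (jumps \<sigma>) \<subseteq> Min ` P"
  proof
    fix m assume m: "m \<in> insert (Min UNIV) (jumps \<sigma>)"
    obtain B where B: "B \<in> P" "m \<in> B"
      using block by blast
    obtain a b where ab: "B = {a..b}"
      using interval B by blast
    \<comment> \<open>The predecessor \<open>l\<close> of a jump \<open>m\<close> carries a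
      different value and so lies outside the block. A block that is an interval containing
      \<open>m\<close> but not \<open>l\<close> has no element up to \<open>l\<close>, and nothing
      lies between \<open>l\<close> and \<open>m\<close>.\<close>
    have "m \<le> k" if "k \<in> B" for k
    proof (cases "m = Min UNIV")
      case False
      with m obtain l where l: "l < m" "{l<..<m} = {}" "\<sigma> $ l \<noteq> \<sigma> $ m"
        by (auto simp: jumps_def)
      then have "l \<notin> B"
        using const B by blast
      then have "l < k"
        using ab B l that by auto
      with l show ?thesis
        using leI by fastforce
    qed simp
    then have "Min B = m"
      using B by (intro Min_eqI) auto
    then show "m \<in> Min ` P"
      using B by blast
  qed
  then have "card (insert (Min UNIV) (jumps \<sigma>)) \<le> card P"
    by (rule surj_card_le[rotated]) simp
  finally show ?thesis
    using card by simp
qed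

lemma convex_eq_interval:
  fixes B :: "'a::{finite,linorder} set"
  assumes "B \<noteq> {}" and "\<And>a b c. a \<in> B \<Longrightarrow> c \<in> B \<Longrightarrow> a \<le> b \<Longrightarrow> b \<le> c \<Longrightarrow> b \<in> B"
  shows "B = {Min B..Max B}"
proof
  show "{Min B..Max B} \<subseteq> B"
  proof
    fix b assume "b \<in> {Min B..Max B}"
    moreover have "Min B \<in> B" "Max B \<in> B"
      using assms(1) by (auto intro: Min_in Max_in)
    ultimately show "b \<in> B"
      using assms(2)[of "Min B" "Max B" b] by simp
  qed
qed auto

text \<open>The blocks are the fibres of the function counting the jumps up to a given index.\<close>

lemma contiguous_partition_constant_blocks:
  fixes \<sigma> :: "real ^ 'n::{finite,linorder}"
  obtains j P where "j \<in> {1..Suc (card (jumps \<sigma>))}" and "P \<in> contiguous_partitions j"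
    and "\<And>B m n. B \<in> P \<Longrightarrow> m \<in> B \<Longrightarrow> n \<in> B \<Longrightarrow> \<sigma> $ m = \<sigma> $ n"
proof
  define h where "h n = card (jumps \<sigma> \<inter> {..n})" for n
  define P where "P = (\<lambda>y. h -` {y}) ` range h"
  have h_mono: "h m \<le> h n" if "m \<le> n" for m n
    unfolding h_def using that by (intro card_mono) auto
  have part: "partition_on UNIV P"
    unfolding P_def by (rule partition_onI) (auto simp: disjnt_def)
  have "P \<noteq> {}"
    by (auto simp: P_def)
  then have "1 \<le> card P"
    by (simp add: Suc_le_eq card_gt_0_iff)
  \<comment> \<open>The count starts at 0, so it takes at most one value more than there are
    jumps.\<close>
  moreover have "range h \<subseteq> {..card (jumps \<sigma>)}"
    unfolding h_def by (auto intro!: card_mono)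
  then have "card (range h) \<le> Suc (card (jumps \<sigma>))"
    using card_mono[of "{..card (jumps \<sigma>)}" "range h"] by simp
  then have "card P \<le> Suc (card (jumps \<sigma>))"
    unfolding P_def using card_image_le[of "range h" "\<lambda>y. h -` {y}"] by simp
  ultimately show "card P \<in> {1..Suc (card (jumps \<sigma>))}"
    by simp
  have "\<exists>a b. B = {a..b}" if "B \<in> P" for B
  proof -
    obtain n where B: "B = h -` {h n}"
      using \<open>B \<in> P\<close> unfolding P_def by blast
    have "B = {Min B..Max B}"
    proof (rule convex_eq_interval)
      fix a b c assume "a \<in> B" "c \<in> B" "a \<le> b" "b \<le> c"
      then show "b \<in> B"
        unfolding B using h_mono[of a b] h_mono[of b c] by simp
    qed (auto simp: B)
    then show ?thesis
      by blast
  qed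
  with part show "P \<in> contiguous_partitions (card P)"
    by (simp add: contiguous_partitions_def)
  have eq: "\<sigma> $ m = \<sigma> $ n" if "h m = h n" "m \<le> n" for m n
  proof (rule eq_if_no_jumps_between)
    \<comment> \<open>The left set is contained in the right one and has the same finite
      cardinality.\<close>
    have "jumps \<sigma> \<inter> {..m} = jumps \<sigma> \<inter> {..n}"
      using that unfolding h_def by (intro card_subset_eq) auto
    then have "k \<le> m" if "k \<in> jumps \<sigma>" "k \<le> n" for k
      using that by blast
    then show "jumps \<sigma> \<inter> {m<..n} = {}"
      unfolding disjoint_iff greaterThanAtMost_iff using leD by blast
  qed fact
  show "\<sigma> $ m = \<sigma> $ n" if "B \<in> P" "m \<in> B" "n \<in> B" for B m n
  proof -
    have "h m = h n"
      using that unfolding P_def by auto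
    then show ?thesis
      using eq[of m n] eq[of n m] linear[of m n] by argo
  qed
qed

section \<open>AM-GM on the blocks of a partition\<close>

lemma power2_norm_eq_sum_blocks:
  fixes x :: "real ^ 'n::finite"
  assumes "partition_on UNIV P"
  shows "(norm x)\<^sup>2 = (\<Sum>B\<in>P. (L2_set (\<lambda>n. x $ n) B)\<^sup>2)"
proof -
  have "(norm x)\<^sup>2 = (\<Sum>n\<in>UNIV. (x $ n)\<^sup>2)"
    by (simp add: norm_vec_def L2_set_def sum_nonneg)
  also have "UNIV = \<Union>P"
    using partition_onD1[OF assms] .
  also have "(\<Sum>n\<in>\<Union>P. (x $ n)\<^sup>2) = (\<Sum>B\<in>P. \<Sum>n\<in>B. (x $ n)\<^sup>2)"
    using partition_onD2[OF assms]
    by (subst sum.Union_disjoint) (auto simp: disjoint_def)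
  finally show ?thesis
    by (simp add: L2_set_def sum_nonneg)
qed

lemma L2_set_constant_power2:
  assumes "\<And>n. n \<in> B \<Longrightarrow> f n = s"
  shows "(L2_set f B)\<^sup>2 = real (card B) * s\<^sup>2"
  using assms by (simp add: L2_set_def sum_nonneg)

text \<open>The weight \<open>sqrt (card B)\<close> is what turns \<bar>s\<bar> into the norm of
  \<sigma> on \<open>B\<close>. Each summand is thus a product of the norms of \<open>u\<close> and
  \<sigma> on \<open>B\<close>, ready for AM-GM.\<close>

lemma block_cost_mult_le:
  fixes u \<sigma> :: "real ^ 'n::finite"
  assumes part: "partition_on UNIV P"
    and const: "\<And>B m n. B \<in> P \<Longrightarrow> m \<in> B \<Longrightarrow> n \<in> B \<Longrightarrow> \<sigma> $ m = \<sigma> $ n"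
  shows "block_cost (u * \<sigma>) P \<le> ((norm u)\<^sup>2 + (norm \<sigma>)\<^sup>2) / 2"
proof -
  have "sqrt (real (card B)) * L2_set (\<lambda>n. (u * \<sigma>) $ n) B
      \<le> ((L2_set (\<lambda>n. u $ n) B)\<^sup>2 + (L2_set (\<lambda>n. \<sigma> $ n) B)\<^sup>2) / 2" if "B \<in> P" for B
  proof -
    have "\<exists>s. \<forall>n\<in>B. \<sigma> $ n = s"
    proof (cases "B = {}")
      case False
      then obtain m where "m \<in> B"
        by blast
      then show ?thesis
        using const \<open>B \<in> P\<close> by blast
    qed simp
    then obtain s where s: "\<And>n. n \<in> B \<Longrightarrow> \<sigma> $ n = s"
      by blast
    define L where "L = L2_set (\<lambda>n. u $ n) B"
    have "L2_set (\<lambda>n. (u * \<sigma>) $ n) B = L2_set (\<lambda>n. \<bar>s\<bar> * u $ n) B"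
      using s by (simp add: L2_set_def power_mult_distrib mult.commute)
    also have "\<dots> = \<bar>s\<bar> * L"
      unfolding L_def by (simp add: L2_set_right_distrib)
    finally have "sqrt (real (card B)) * L2_set (\<lambda>n. (u * \<sigma>) $ n) B
        = L * (sqrt (real (card B)) * \<bar>s\<bar>)"
      by simp
    also have "\<dots> \<le> (L\<^sup>2 + (sqrt (real (card B)) * \<bar>s\<bar>)\<^sup>2) / 2"
      using sum_squares_bound[of L "sqrt (real (card B)) * \<bar>s\<bar>"] by simp
    also have "(sqrt (real (card B)) * \<bar>s\<bar>)\<^sup>2 = (L2_set (\<lambda>n. \<sigma> $ n) B)\<^sup>2"
      using L2_set_constant_power2[of B "\<lambda>n. \<sigma> $ n" s] s by (simp add: power_mult_distrib)
    finally show ?thesis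
      by (simp add: L_def)
  qed
  then have "block_cost (u * \<sigma>) P
      \<le> (\<Sum>B\<in>P. ((L2_set (\<lambda>n. u $ n) B)\<^sup>2 + (L2_set (\<lambda>n. \<sigma> $ n) B)\<^sup>2) / 2)"
    unfolding block_cost_def by (rule sum_mono)
  also have "\<dots> = ((norm u)\<^sup>2 + (norm \<sigma>)\<^sup>2) / 2"
    by (simp add: power2_norm_eq_sum_blocks[OF part] sum.distrib flip: sum_divide_distrib)
  finally show ?thesis .
qed

lemma block_cost_attained:
  fixes x :: "real ^ 'n::finite"
  assumes part: "partition_on UNIV P"
  obtains u \<sigma> :: "real ^ 'n" where "x = u * \<sigma>"
    and "\<And>B m n. B \<in> P \<Longrightarrow> m \<in> B \<Longrightarrow> n \<in> B \<Longrightarrow> \<sigma> $ m = \<sigma> $ n"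
    and "block_cost x P = ((norm u)\<^sup>2 + (norm \<sigma>)\<^sup>2) / 2"
proof -
  define blk where "blk n = (SOME B. B \<in> P \<and> n \<in> B)" for n
  \<comment> \<open>Equality in AM-GM requires \<open>u\<close> and \<sigma> to have the same norm
    on \<open>B\<close>. With \<open>L\<close> the norm of \<open>x\<close> on \<open>B\<close> and
    \<open>c = sqrt (card B)\<close>, a constant value \<open>s > 0\<close> of \<sigma> gives the
    condition \<open>L / s = c * s\<close>, so the square of \<open>s\<close> is
    \<open>L / c\<close>.\<close>
  define s where "s B = sqrt (L2_set (\<lambda>n. x $ n) B / sqrt (real (card B)))" for B
  have "\<exists>B. B \<in> P \<and> n \<in> B" for n
    using partition_onD1[OF part] by blast
  then have blk: "blk n \<in> P \<and> n \<in> blk n" for n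
    unfolding blk_def by (rule someI_ex)
  have blk_eq: "blk n = B" if "B \<in> P" "n \<in> B" for n B
    using blk[of n] that partition_onD2[OF part] by (auto simp: disjoint_def)
  define \<sigma> :: "real ^ 'n" where "\<sigma> = (\<chi> n. s (blk n))"
  \<comment> \<open>Where \<sigma> vanishes, so does \<open>x\<close> on the whole block. Division
    by zero then yields 0 for \<open>u\<close>, and the product still equals
    \<open>x\<close>.\<close>
  define u :: "real ^ 'n" where "u = (\<chi> n. x $ n / \<sigma> $ n)"
  have \<sigma>_eq: "\<sigma> $ n = s B" if "B \<in> P" "n \<in> B" for n B
    using blk_eq[OF that] by (simp add: \<sigma>_def)
  have x_zero: "x $ n = 0" if "s B = 0" "n \<in> B" for n B
  proof -
    have "card B \<noteq> 0"
      using that by auto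
    then have "L2_set (\<lambda>n. x $ n) B = 0"
      using that by (simp add: s_def)
    then show ?thesis
      using that by (simp add: L2_set_eq_0_iff)
  qed
  have "x $ n = (u * \<sigma>) $ n" for n
    using x_zero[of "blk n" n] blk[of n] \<sigma>_eq[of "blk n" n] by (auto simp: u_def)
  then have "x = u * \<sigma>"
    by (simp add: Finite_Cartesian_Product.vec_eq_iff)
  moreover have "\<sigma> $ m = \<sigma> $ n" if "B \<in> P" "m \<in> B" "n \<in> B" for B m n
    using \<sigma>_eq that by simp
  moreover have "sqrt (real (card B)) * L2_set (\<lambda>n. x $ n) B
      = ((L2_set (\<lambda>n. u $ n) B)\<^sup>2 + (L2_set (\<lambda>n. \<sigma> $ n) B)\<^sup>2) / 2" if B: "B \<in> P" for B
  proof -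
    define L where "L = L2_set (\<lambda>n. x $ n) B"
    define c where "c = sqrt (real (card B))"
    have "B \<noteq> {}"
      using B partition_onD3[OF part] by auto
    then have c: "c > 0" "c\<^sup>2 = real (card B)"
      by (auto simp: c_def card_gt_0_iff)
    have L: "L \<ge> 0"
      by (simp add: L_def)
    have s2: "(s B)\<^sup>2 = L / c"
      using c L by (simp add: s_def L_def c_def)
    have "(L2_set (\<lambda>n. \<sigma> $ n) B)\<^sup>2 = c\<^sup>2 * (s B)\<^sup>2"
      using L2_set_constant_power2[of B "\<lambda>n. \<sigma> $ n" "s B"] \<sigma>_eq[OF B]
      unfolding c(2) by blast
    also have "\<dots> = c * L"
      unfolding s2 using c(1) by (simp add: power2_eq_square)
    finally have \<sigma>2: "(L2_set (\<lambda>n. \<sigma> $ n) B)\<^sup>2 = c * L" .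
    have "(L2_set (\<lambda>n. u $ n) B)\<^sup>2 = (\<Sum>n\<in>B. (x $ n)\<^sup>2 / (s B)\<^sup>2)"
      using \<sigma>_eq B by (simp add: L2_set_def sum_nonneg u_def power_divide)
    also have "\<dots> = L\<^sup>2 / (s B)\<^sup>2"
      by (simp add: L_def L2_set_def sum_nonneg sum_divide_distrib)
    \<comment> \<open>This includes \<open>L = 0\<close>, where the quotient is 0 by the convention
      for division by zero.\<close>
    also have "\<dots> = c * L"
      unfolding s2 by (simp add: power2_eq_square)
    finally show ?thesis
      using \<sigma>2 by (simp add: L_def c_def)
  qed
  then have "block_cost x P
      = (\<Sum>B\<in>P. ((L2_set (\<lambda>n. u $ n) B)\<^sup>2 + (L2_set (\<lambda>n. \<sigma> $ n) B)\<^sup>2) / 2)"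
    unfolding block_cost_def by (rule sum.cong[OF refl])
  then have "block_cost x P = ((norm u)\<^sup>2 + (norm \<sigma>)\<^sup>2) / 2"
    by (simp add: power2_norm_eq_sum_blocks[OF part] sum.distrib flip: sum_divide_distrib)
  ultimately show ?thesis
    using that by blast
qed

section \<open>The penalty as a minimum over feasible factorizations\<close>

lemma lop_penalty_mult_le:
  fixes u \<sigma> :: "real ^ 'n::{finite,linorder}"
  assumes "K \<ge> 1" "dwf_feasible K (u, \<sigma>)"
  shows "lop_penalty K (u * \<sigma>) \<le> ((norm u)\<^sup>2 + (norm \<sigma>)\<^sup>2) / 2"
proof -
  obtain j P where j: "j \<in> {1..Suc (card (jumps \<sigma>))}" and P: "P \<in> contiguous_partitions j"
    and const: "\<And>B m n. B \<in> P \<Longrightarrow> m \<in> B \<Longrightarrow> n \<in> B \<Longrightarrow> \<sigma> $ m = \<sigma> $ n"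
    using contiguous_partition_constant_blocks[of \<sigma>] by blast
  have "card (jumps \<sigma>) \<le> K - 1"
    using assms(2) by (simp add: dwf_feasible_def l0_norm_diff_eq_card_jumps)
  \<comment> \<open>As \<open>K \<ge> 1\<close>, the truncated difference satisfies
    \<open>Suc (K - 1) = K\<close>, so the partition competes in the minimum defining the
    penalty.\<close>
  then have "j \<in> {1..K}"
    using j assms(1) by auto
  then have "lop_penalty K (u * \<sigma>) \<le> block_cost (u * \<sigma>) P"
    unfolding lop_penalty_def using P
    by (intro Min_le lop_penalty_Min_well_defined(1)[OF assms(1)]) blast
  also have "\<dots> \<le> ((norm u)\<^sup>2 + (norm \<sigma>)\<^sup>2) / 2"
  proof (rule block_cost_mult_le)
    show "partition_on UNIV P"
      using P by (simp add: contiguous_partitions_def)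
  qed (fact const)
  finally show ?thesis .
qed

text \<open>Take the balanced factorization on an optimal partition: its \<open>j \<le> K\<close>
  blocks leave fewer than \<open>j\<close> jumps, which is feasibility.\<close>

lemma lop_penalty_attained:
  fixes x :: "real ^ 'n::{finite,linorder}"
  assumes "K \<ge> 1"
  obtains u \<sigma> :: "real ^ 'n::{finite,linorder}" where "x = u * \<sigma>" "dwf_feasible K (u, \<sigma>)"
    and "lop_penalty K x = ((norm u)\<^sup>2 + (norm \<sigma>)\<^sup>2) / 2"
proof -
  have "lop_penalty K x \<in> (\<Union>j\<in>{1..K}. block_cost x ` contiguous_partitions j)"
    unfolding lop_penalty_def by (intro Min_in lop_penalty_Min_well_defined assms)
  then obtain j P where j: "j \<in> {1..K}" and P: "P \<in> contiguous_partitions j"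
    and cost: "lop_penalty K x = block_cost x P"
    by blast
  have part: "partition_on UNIV P"
    using P by (simp add: contiguous_partitions_def)
  obtain u \<sigma> :: "real ^ 'n::{finite,linorder}" where us: "x = u * \<sigma>"
    and const: "\<And>B m n. B \<in> P \<Longrightarrow> m \<in> B \<Longrightarrow> n \<in> B \<Longrightarrow> \<sigma> $ m = \<sigma> $ n"
    and eq: "block_cost x P = ((norm u)\<^sup>2 + (norm \<sigma>)\<^sup>2) / 2"
    using block_cost_attained[OF part] by blast
  have "card (jumps \<sigma>) < j"
    using P const by (rule card_jumps_less_card_partition)
  then have "dwf_feasible K (u, \<sigma>)"
    using j by (auto simp: dwf_feasible_def l0_norm_diff_eq_card_jumps)
  with us cost eq that show ?thesis
    by simp
qed

theorem theorem1:
  fixes g :: "real ^ 'n::{finite,linorder} \<Rightarrow> real"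
    and lam :: real and K :: nat
  assumes "lam \<ge> 0"
    and "K \<ge> 1"
    and "\<And>x. g differentiable (at x)"
  shows "(INF x. ereal (lop_objective g lam K x))
           = (INF p\<in>{p. dwf_feasible K p}. ereal (dwf_objective g lam p))
    \<and> (\<forall>x. is_arg_min (lop_objective g lam K) (\<lambda>_. True) x \<longleftrightarrow>
          (\<exists>u \<sigma>. x = u * \<sigma> \<and> is_arg_min (dwf_objective g lam) (dwf_feasible K) (u, \<sigma>)))"
proof -
  \<comment> \<open>The rest of the argument is formal, from \<open>le\<close> and
    \<open>attained\<close>: a feasible pair never has a smaller value than its product, and every
    \<open>x\<close> has a feasible factorization of the same value.\<close>
  have le: "lop_objective g lam K (u * \<sigma>) \<le> dwf_objective g lam (u, \<sigma>)"
    if "dwf_feasible K (u, \<sigma>)" for u \<sigma>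
    using mult_left_mono[OF lop_penalty_mult_le[OF assms(2) that] assms(1)]
    by (simp add: lop_objective_def dwf_objective_def)
  have attained: "\<exists>u \<sigma>. x = u * \<sigma> \<and> dwf_feasible K (u, \<sigma>)
      \<and> dwf_objective g lam (u, \<sigma>) = lop_objective g lam K x" for x
  proof -
    obtain u \<sigma> where "x = u * \<sigma>" "dwf_feasible K (u, \<sigma>)"
      and "lop_penalty K x = ((norm u)\<^sup>2 + (norm \<sigma>)\<^sup>2) / 2"
      using lop_penalty_attained[OF assms(2)] by blast
    then have "dwf_objective g lam (u, \<sigma>) = lop_objective g lam K x"
      by (simp add: lop_objective_def dwf_objective_def)
    with \<open>x = u * \<sigma>\<close> \<open>dwf_feasible K (u, \<sigma>)\<close> show ?thesis
      by blast
  qed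
  \<comment> \<open>Infima in \<open>ereal\<close> agree even if no minimizer exists or the
    objectives are unbounded below.\<close>
  have "(INF x. ereal (lop_objective g lam K x))
      = (INF p\<in>{p. dwf_feasible K p}. ereal (dwf_objective g lam p))"
  proof (rule antisym)
    show "(INF x. ereal (lop_objective g lam K x))
        \<le> (INF p\<in>{p. dwf_feasible K p}. ereal (dwf_objective g lam p))"
      by (rule INF_mono) (use le in fastforce)
    show "(INF p\<in>{p. dwf_feasible K p}. ereal (dwf_objective g lam p))
        \<le> (INF x. ereal (lop_objective g lam K x))"
      by (rule INF_mono) (metis attained mem_Collect_eq order_refl)
  qed
  moreover have "is_arg_min (lop_objective g lam K) (\<lambda>_. True) x \<longleftrightarrow>
      (\<exists>u \<sigma>. x = u * \<sigma> \<and> is_arg_min (dwf_objective g lam) (dwf_feasible K) (u, \<sigma>))" for x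
  proof
    assume min: "is_arg_min (lop_objective g lam K) (\<lambda>_. True) x"
    obtain u \<sigma> where us: "x = u * \<sigma>" "dwf_feasible K (u, \<sigma>)"
      "dwf_objective g lam (u, \<sigma>) = lop_objective g lam K x"
      using attained by blast
    have "dwf_objective g lam (u, \<sigma>) \<le> dwf_objective g lam (v, \<tau>)"
      if "dwf_feasible K (v, \<tau>)" for v \<tau>
      using le[OF that] min us(3) by (auto simp: is_arg_min_linorder intro: order_trans)
    then have "is_arg_min (dwf_objective g lam) (dwf_feasible K) (u, \<sigma>)"
      using us(2) by (simp add: is_arg_min_linorder split_paired_all)
    with us(1) show "\<exists>u \<sigma>. x = u * \<sigma> \<and> is_arg_min (dwf_objective g lam) (dwf_feasible K) (u, \<sigma>)"
      by blast
  next
    assume "\<exists>u \<sigma>. x = u * \<sigma> \<and> is_arg_min (dwf_objective g lam) (dwf_feasible K) (u, \<sigma>)"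
    then obtain u \<sigma> where us: "x = u * \<sigma>" "dwf_feasible K (u, \<sigma>)"
      and min: "\<And>p. dwf_feasible K p \<Longrightarrow> dwf_objective g lam (u, \<sigma>) \<le> dwf_objective g lam p"
      by (auto simp: is_arg_min_linorder)
    \<comment> \<open>Compare through factorizations: the value at \<open>x\<close> is at most that
      of its optimal pair, which is at most that of the pair attaining the value at
      \<open>y\<close>.\<close>
    have "lop_objective g lam K x \<le> lop_objective g lam K y" for y
      using le[OF us(2)] us(1) attained[of y] min by (metis order_trans)
    then show "is_arg_min (lop_objective g lam K) (\<lambda>_. True) x"
      by (simp add: is_arg_min_linorder)
  qed
  ultimately show ?thesis
    by blast
qed

end
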